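(* Let $c \in \mathbb{Q}$ be such that $\operatorname{den}(c) = d^2$ with $d$ a positive multiple of $4$. Let $s = |\operatorname{supp}(d)|$. Then $$|\operatorname{Per}(\varphi_c)| \le 2^s + 2.$$
   Context: For $c \in \mathbb{Q}$, $\varphi_c \colon \mathbb{Q} \to \mathbb{Q}$ is the map $\varphi_c(x) = x^2 - c$. $\operatorname{Per}(\varphi_c)$ is the set of rational periodic points of $\varphi_c$, i.e. of $x \in \mathbb{Q}$ with $\varphi_c^n(x) = x$ for some integer $n \ge 1$ ($n$-th iterate). For $z \in \mathbb{Q}$, $\operatorname{den}(z) \ge 1$ is the denominator of $z$ in lowest terms. For a nonzero integer $d$, $\operatorname{supp}(d)$ is the set of prime numbers dividing $d$. *)

theory Defs
  imports Complex_Main "HOL-Computational_Algebra.Primes"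
begin

definition phi :: "rat \<Rightarrow> rat \<Rightarrow> rat" where
  "phi c x = x\<^sup>2 - c"

definition Per :: "(rat \<Rightarrow> rat) \<Rightarrow> rat set" where
  "Per f = {x. \<exists>n\<ge>1. (f ^^ n) x = x}"

(* quotient_of returns the coprime numerator/denominator pair with positive denominator *)
definition den :: "rat \<Rightarrow> int" where
  "den z = snd (quotient_of z)"

definition supp :: "int \<Rightarrow> int set" where
  "supp d = {p. prime p \<and> p dvd d}"

end

theory Submission
  imports Defs
begin

text \<open>
  Let \<open>c = a / d\<^sup>2\<close> in lowest terms.  Comparing denominators along a cycle shows that every periodic
  point has the form \<open>X / d\<close> with \<open>X\<close> an integer; since \<open>d X' = X\<^sup>2 - a\<close> for the next point \<open>X' / d\<close>,
  all these numerators are coprime to \<open>d\<close> and have the same square modulo \<open>d\<close>.  Hence two numerators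
  agree up to sign modulo each odd prime divisor of \<open>d\<close>, and modulo \<open>4\<close> because they are odd.  This
  sorts the numerators into at most \<open>2\<^sup>s\<close> sign classes.

  The second ingredient is multiplicative.  From \<open>\<phi> x - \<phi> y = (x - y) (x + y)\<close> it follows that, for
  distinct periodic points, the product of the sums \<open>x\<^sub>i + y\<^sub>i\<close> over a common period is \<open>1\<close>, so
  \<open>X + Y\<close> divides a power of \<open>d\<close>.  If \<open>X\<close> and \<open>Y\<close> lie in the same sign class, no odd prime divisor of
  \<open>d\<close> divides \<open>X + Y\<close>, and \<open>2\<close> divides it exactly once, which leaves \<open>X + Y = 2\<close> or \<open>X + Y = -2\<close>.

  Finally each of the two values is attained by at most one such pair: a sum \<open>2e\<close> with \<open>e = \<plusminus>1\<close>
  forces \<open>X \<equiv> Y \<equiv> e\<close> modulo every odd prime divisor of \<open>d\<close>, so the members of two such pairs can only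
  differ in their class modulo \<open>4\<close>, and then the mixed sums are powers of two up to sign whose
  possible values are too few.  Removing one member of each of these at most two pairs leaves at
  most one numerator in each class.
\<close>

section \<open>Numerators of periodic points\<close>

text \<open>Subtracting an integer does not change the denominator of \<open>w\<^sup>2\<close>, and multiplying \<open>w'\<close> by an
  integer cannot enlarge that of \<open>w'\<close>.\<close>

lemma den_power2_le_of_step:
  fixes w w' :: rat and a d :: int
  assumes step: "of_int d * w' = w\<^sup>2 - of_int a"
  shows "(den w)\<^sup>2 \<le> den w'"
proof -
  obtain u m where w: "quotient_of w = (u, m)" by fastforce
  obtain u' m' where w': "quotient_of w' = (u', m')" by fastforce
  have pos: "m > 0" "m' > 0" using w w' quotient_of_denom_pos by auto
  have cop: "coprime u m" using w quotient_of_coprime by auto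
  have frac: "w = of_int u / of_int m" "w' = of_int u' / of_int m'"
    using w w' quotient_of_div by auto
  have "(of_int ((u\<^sup>2 - a * m\<^sup>2) * m') :: rat) = of_int (d * u' * m\<^sup>2)"
    using step pos unfolding frac by (simp add: field_simps power2_eq_square)
  then have eq: "(u\<^sup>2 - a * m\<^sup>2) * m' = d * u' * m\<^sup>2" by (simp only: of_int_eq_iff)
  have "coprime (m\<^sup>2) (u\<^sup>2)" using cop by (simp add: coprime_commute)
  then have "coprime (m\<^sup>2) (u\<^sup>2 - a * m\<^sup>2)"
  proof (rule coprime_imp_coprime)
    fix q assume q: "q dvd m\<^sup>2" "q dvd u\<^sup>2 - a * m\<^sup>2"
    then have "q dvd (u\<^sup>2 - a * m\<^sup>2) + a * m\<^sup>2" by (intro dvd_add dvd_mult)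
    then show "q dvd u\<^sup>2" by simp
  qed
  moreover have "m\<^sup>2 dvd (u\<^sup>2 - a * m\<^sup>2) * m'" unfolding eq by simp
  ultimately have "m\<^sup>2 dvd m'" by (simp add: coprime_dvd_mult_right_iff)
  then show ?thesis using pos w w' by (simp add: den_def zdvd_imp_le)
qed

lemma den_pos: "den x > 0"
  unfolding den_def by (rule quotient_of_denom_pos')

lemma Ints_if_den_eq_1: "den x = 1 \<Longrightarrow> x \<in> \<int>"
proof -
  assume "den x = 1"
  then have "quotient_of x = (fst (quotient_of x), 1)" unfolding den_def by (simp add: prod_eq_iff)
  then have "x = of_int (fst (quotient_of x)) / of_int 1" by (rule quotient_of_div)
  then have "x = of_int (fst (quotient_of x))" by simp
  then show ?thesis by (metis Ints_of_int)
qed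

lemma Per_funpow: "x \<in> Per f \<Longrightarrow> (f ^^ i) x \<in> Per f"
proof -
  assume "x \<in> Per f"
  then obtain n where n: "n \<ge> 1" "(f ^^ n) x = x" unfolding Per_def by auto
  have "(f ^^ n) ((f ^^ i) x) = (f ^^ (n + i)) x" by (simp add: funpow_add)
  also have "\<dots> = (f ^^ i) ((f ^^ n) x)" by (subst add.commute) (simp add: funpow_add)
  finally show ?thesis using n unfolding Per_def by auto
qed

text \<open>Along an orbit the denominators of \<open>d x\<^sub>i\<close> at least square in each step; returning to the start
  is only possible if they are all \<open>1\<close>.\<close>

lemma Per_numerator_Ints:
  assumes c: "c = of_int a / (of_int d)\<^sup>2" and d: "d \<noteq> 0" and x: "x \<in> Per (phi c)"
  shows "of_int d * x \<in> \<int>"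
proof -
  define w where "w i = of_int d * (phi c ^^ i) x" for i
  have "of_int d * w (Suc i) = (w i)\<^sup>2 - of_int a" for i
    using d unfolding w_def by (simp add: phi_def c field_simps power2_eq_square)
  then have sq: "(den (w i))\<^sup>2 \<le> den (w (Suc i))" for i
    by (rule den_power2_le_of_step)
  have "den (w i) \<le> (den (w i))\<^sup>2" for i
    using den_pos[of "w i"] by (simp add: self_le_power)
  then have mono: "den (w i) \<le> den (w (Suc i))" for i
    using sq order_trans by blast
  obtain n where n: "n \<ge> 1" "(phi c ^^ n) x = x" using x unfolding Per_def by auto
  have "den (w (Suc 0)) \<le> den (w n)"
    using lift_Suc_mono_le[of "\<lambda>i. den (w i)"] mono n(1) by simp
  moreover have "w n = w 0" using n unfolding w_def by simp
  ultimately have "(den (w 0))\<^sup>2 \<le> den (w 0)" using sq[of 0] by simp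
  then have "den (w 0) * den (w 0) \<le> den (w 0) * 1" by (simp add: power2_eq_square)
  then have "den (w 0) \<le> 1" using den_pos[of "w 0"] by (simp only: mult_le_cancel_left_pos)
  then have "den (w 0) = 1" using den_pos[of "w 0"] by linarith
  then show ?thesis using Ints_if_den_eq_1 by (fastforce simp: w_def)
qed

lemma phi_funpow_diff:
  "(phi c ^^ n) x - (phi c ^^ n) y = (x - y) * (\<Prod>i<n. (phi c ^^ i) x + (phi c ^^ i) y)"
proof (induction n)
  case (Suc n)
  have "(phi c ^^ Suc n) x - (phi c ^^ Suc n) y =
      ((phi c ^^ n) x - (phi c ^^ n) y) * ((phi c ^^ n) x + (phi c ^^ n) y)"
    by (simp add: phi_def power2_eq_square algebra_simps)
  then show ?case using Suc by (simp add: mult.assoc)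
qed simp

lemma Per_common_period:
  assumes "x \<in> Per f" "y \<in> Per f"
  shows "\<exists>n\<ge>1. (f ^^ n) x = x \<and> (f ^^ n) y = y"
proof -
  obtain m n where mn: "m \<ge> 1" "(f ^^ m) x = x" "n \<ge> 1" "(f ^^ n) y = y"
    using assms unfolding Per_def by auto
  have iter: "((f ^^ k) ^^ l) z = z" if "(f ^^ k) z = z" for k l z
    using that by (induction l) auto
  have "(f ^^ (m * n)) x = x" "(f ^^ (m * n)) y = y"
    using iter[OF mn(2), of n] iter[OF mn(4), of m]
    by (simp_all add: funpow_mult mult.commute)
  moreover have "m * n \<ge> 1" using mn by (simp add: Suc_le_eq)
  ultimately show ?thesis by blast
qed

definition numerators :: "rat \<Rightarrow> int \<Rightarrow> int set" where
  "numerators c d = {X. of_int X / of_int d \<in> Per (phi c)}"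

lemma Per_eq_image_numerators:
  assumes "c = of_int a / (of_int d)\<^sup>2" and "d \<noteq> 0"
  shows "Per (phi c) = (\<lambda>X. of_int X / of_int d) ` numerators c d"
proof (intro equalityI subsetI)
  fix x assume x: "x \<in> Per (phi c)"
  then obtain X where "of_int d * x = of_int X"
    using Per_numerator_Ints[OF assms] Ints_cases by blast
  then have "x = of_int X / of_int d" using \<open>d \<noteq> 0\<close> by (simp add: field_simps)
  then show "x \<in> (\<lambda>X. of_int X / of_int d) ` numerators c d"
    using x unfolding numerators_def by auto
qed (auto simp: numerators_def)

lemma numerator_square_cong:
  assumes "c = of_int a / (of_int d)\<^sup>2" and "d \<noteq> 0" and "X \<in> numerators c d"
  shows "d dvd X\<^sup>2 - a"
proof -
  have "phi c (of_int X / of_int d) \<in> Per (phi c)"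
    using Per_funpow[of _ "phi c" 1] assms(3) unfolding numerators_def by simp
  then obtain Y where "of_int d * phi c (of_int X / of_int d) = of_int Y"
    using Per_numerator_Ints[OF assms(1,2)] Ints_cases by blast
  moreover have "of_int d * phi c (of_int X / of_int d) = of_int (X\<^sup>2 - a) / of_int d"
    using \<open>d \<noteq> 0\<close> by (simp add: phi_def assms(1) power2_eq_square flip: diff_divide_distrib)
  ultimately have "(of_int (X\<^sup>2 - a) :: rat) = of_int (d * Y)"
    using \<open>d \<noteq> 0\<close> by (simp add: nonzero_divide_eq_eq mult.commute)
  then have "X\<^sup>2 - a = d * Y" by (simp only: of_int_eq_iff)
  then show ?thesis by simp
qed

text \<open>Over a common period of length \<open>n\<close> the product of the sums of the points is \<open>1\<close>; clearing
  denominators turns it into a factorisation of \<open>d ^ n\<close> into integers, one of which is \<open>X + Y\<close>.\<close>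

lemma numerator_sum_dvd_power:
  assumes "c = of_int a / (of_int d)\<^sup>2" and "d \<noteq> 0"
    and "X \<in> numerators c d" "Y \<in> numerators c d" "X \<noteq> Y"
  shows "\<exists>n. X + Y dvd d ^ n"
proof -
  define x y :: rat where "x = of_int X / of_int d" and "y = of_int Y / of_int d"
  have per: "x \<in> Per (phi c)" "y \<in> Per (phi c)"
    using assms unfolding numerators_def x_def y_def by auto
  obtain n where n: "n \<ge> 1" "(phi c ^^ n) x = x" "(phi c ^^ n) y = y"
    using Per_common_period[OF per] by auto
  define t where "t i = of_int d * (phi c ^^ i) x + of_int d * (phi c ^^ i) y" for i
  have "x \<noteq> y" using assms(2,5) unfolding x_def y_def by simp
  then have "(\<Prod>i<n. (phi c ^^ i) x + (phi c ^^ i) y) = 1"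
    using phi_funpow_diff[where n = n and c = c and x = x and y = y] n by simp
  then have "(\<Prod>i<n. t i) = of_int d ^ n"
    unfolding t_def by (simp flip: distrib_left add: prod.distrib)
  moreover have "(\<Prod>i<n. t i) = t 0 * (\<Prod>i\<in>{..<n} - {0}. t i)"
    using n(1) by (intro prod.remove) auto
  moreover have "(\<Prod>i\<in>{..<n} - {0}. t i) \<in> \<int>"
    unfolding t_def
    by (intro Ints_prod Ints_add Per_numerator_Ints[OF assms(1,2)] Per_funpow per)
  moreover have "t 0 = of_int (X + Y)" using assms(2) unfolding t_def x_def y_def by simp
  ultimately obtain k where "(of_int d ^ n :: rat) = of_int (X + Y) * of_int k"
    by (metis Ints_cases)
  then have "(of_int (d ^ n) :: rat) = of_int ((X + Y) * k)" by simp
  then have "d ^ n = (X + Y) * k" by (simp only: of_int_eq_iff)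
  then show ?thesis by (metis dvd_triv_left)
qed

section \<open>Sign classes of integers with equal squares modulo \<open>d\<close>\<close>

lemma odd_prime_dvd_double:
  fixes p x :: int
  assumes "prime p" "odd p" "p dvd 2 * x"
  shows "p dvd x"
proof -
  have "\<not> p dvd 2" using assms primes_dvd_imp_eq[of p 2] by auto
  then show ?thesis using assms by (simp add: prime_dvd_mult_iff)
qed

lemma abs_power_of_2_if_no_odd_prime:
  fixes z :: int
  assumes "z \<noteq> 0" and "\<And>p. prime p \<Longrightarrow> odd p \<Longrightarrow> \<not> p dvd z"
  shows "\<exists>j. \<bar>z\<bar> = 2 ^ j"
proof -
  obtain y where y: "z = 2 ^ multiplicity 2 z * y" "\<not> 2 dvd y"
    using multiplicity_decompose'[of z 2] assms(1) by auto
  have "is_unit y"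
  proof (rule ccontr)
    assume "\<not> is_unit y"
    moreover have "y \<noteq> 0" using y by auto
    ultimately obtain p where "prime p" "p dvd y" using prime_divisor_exists by blast
    then show False using assms(2) y by (metis dvd_mult dvd_trans)
  qed
  then have "\<bar>y\<bar> = 1" by simp
  then have "\<bar>z\<bar> = 2 ^ multiplicity 2 z" by (subst y(1)) (simp add: abs_mult)
  then show ?thesis ..
qed

text \<open>The only ways to write \<open>\<plusminus>1\<close> as a sum of two signed powers of two are \<open>\<plusminus>(2 - 1)\<close>; here everything
  is scaled by \<open>4\<close>.\<close>

lemma signed_powers_of_2_sum_4:
  fixes u v e :: int
  assumes u: "\<bar>u\<bar> = 2 ^ i" "4 dvd u" and v: "\<bar>v\<bar> = 2 ^ j" "4 dvd v"
    and e: "\<bar>e\<bar> = 1" and sum: "u + v = 4 * e"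
  shows "u = 8 * e \<and> v = - 4 * e \<or> u = - 4 * e \<and> v = 8 * e"
proof -
  \<comment> \<open>One of \<open>u / 4\<close> and \<open>v / 4\<close> is odd, hence \<open>\<plusminus>1\<close>; it is not \<open>e\<close>, as the other would then vanish.\<close>
  have odd_case: "t = - 4 * e"
    if t: "\<bar>t\<bar> = 2 ^ k" "t = 4 * t'" "odd t'" and t2: "t + r = 4 * e" "r \<noteq> 0" for t t' r :: int and k
  proof -
    have "t' dvd 2 ^ k" using t(1,2) by (metis dvd_abs_iff dvd_triv_right)
    moreover have "coprime t' (2 ^ k)" using t(3) by simp
    ultimately have "is_unit t'" by (metis coprime_common_divisor dvd_refl)
    then have "\<bar>t'\<bar> = 1" by simp
    then show ?thesis using t t2 e by arith
  qed
  obtain u' v' where uv: "u = 4 * u'" "v = 4 * v'" using u v by (auto elim!: dvdE)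
  have nz: "u \<noteq> 0" "v \<noteq> 0" using u v by auto
  have "u' + v' = e" using uv sum by simp
  moreover have "odd e" using e by (auto simp: abs_if split: if_splits)
  ultimately have "odd u' \<or> odd v'" by auto
  then have "u = - 4 * e \<or> v = - 4 * e"
    using odd_case[of u i u' v] odd_case[of v j v' u] u v uv nz sum by (auto simp: add.commute)
  then show ?thesis using sum by auto
qed

text \<open>The properties of the set of numerators from which the bound follows by pure arithmetic.\<close>

locale numerator_set =
  fixes d :: int and N :: "int set"
  assumes d_pos: "d > 0" and d_even: "even d"
    and coprime_d: "X \<in> N \<Longrightarrow> coprime X d"
    and square_cong: "X \<in> N \<Longrightarrow> Y \<in> N \<Longrightarrow> d dvd X\<^sup>2 - Y\<^sup>2"
    and sum_dvd_power: "X \<in> N \<Longrightarrow> Y \<in> N \<Longrightarrow> X \<noteq> Y \<Longrightarrow> \<exists>n. X + Y dvd d ^ n"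
begin

definition odd_cong :: "int \<Rightarrow> int \<Rightarrow> bool" where
  "odd_cong X Y \<longleftrightarrow> (\<forall>p\<in>supp d. odd p \<longrightarrow> p dvd X - Y)"

lemma odd_N: "X \<in> N \<Longrightarrow> odd X"
  using coprime_d[of X] d_even coprime_common_divisor[of X d 2] by auto

lemma not_dvd_N:
  assumes "X \<in> N" "p \<in> supp d"
  shows "\<not> p dvd X"
  using assms coprime_d[of X] coprime_common_divisor[of X d p] not_prime_unit
  unfolding supp_def by auto

text \<open>A prime dividing \<open>X + Y\<close> divides \<open>d\<close>; if it is odd it also divides \<open>X - Y\<close>, hence \<open>2 X\<close>, which
  is impossible.\<close>

lemma abs_sum_power_of_2:
  assumes XY: "X \<in> N" "Y \<in> N" "X \<noteq> Y" and cong: "odd_cong X Y"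
  shows "\<exists>j. \<bar>X + Y\<bar> = 2 ^ j"
proof (rule abs_power_of_2_if_no_odd_prime)
  obtain n where n: "X + Y dvd d ^ n" using sum_dvd_power XY by blast
  then show "X + Y \<noteq> 0" using d_pos by auto
  fix p :: int assume p: "prime p" "odd p"
  show "\<not> p dvd X + Y"
  proof
    assume dvd: "p dvd X + Y"
    then have "p dvd d" using n p(1) by (metis dvd_trans prime_dvd_power)
    then have supp: "p \<in> supp d" using p(1) unfolding supp_def by simp
    then have "p dvd X - Y" using cong p(2) unfolding odd_cong_def by blast
    with dvd have "p dvd (X + Y) + (X - Y)" by (rule dvd_add)
    then have "p dvd 2 * X" by (simp only: mult_2) simp
    then have "p dvd X" using odd_prime_dvd_double p by blast
    then show False using not_dvd_N XY supp by blast
  qed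
qed

definition same_class :: "int \<Rightarrow> int \<Rightarrow> bool" where
  "same_class X Y \<longleftrightarrow> odd_cong X Y \<and> 4 dvd X - Y"

text \<open>Two odd numbers that are congruent modulo \<open>4\<close> have a sum congruent to \<open>2\<close>, and \<open>2\<close> is the only
  power of two with this property.\<close>

lemma same_class_sum:
  assumes "X \<in> N" "Y \<in> N" "X \<noteq> Y" "same_class X Y"
  shows "\<bar>X + Y\<bar> = 2"
proof -
  obtain j where j: "\<bar>X + Y\<bar> = 2 ^ j"
    using assms abs_sum_power_of_2 unfolding same_class_def by blast
  have "odd X" "4 dvd X - Y" using assms odd_N unfolding same_class_def by auto
  then have mod: "even (X + Y)" "\<not> 4 dvd X + Y" by presburger+
  then have "even ((2::int) ^ j)" "\<not> 4 dvd (2::int) ^ j"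
    unfolding j[symmetric] by simp_all
  moreover have "4 dvd (2::int) ^ j" if "j \<ge> 2"
    using le_imp_power_dvd[OF that, of "2::int"] by simp
  ultimately have "j = 1" by (cases j; force)
  then show ?thesis using j by simp
qed

text \<open>The sum \<open>\<plusminus>2\<close> determines the pair.  Both pairs lie in the class of \<open>\<plusminus>1\<close> at all odd primes.  If they
  also agree modulo \<open>4\<close>, all pairwise sums are \<open>\<plusminus>2\<close>, which three distinct integers cannot satisfy
  because two of their three sums would be equal; if not, all mixed
  sums are signed powers of two divisible by \<open>4\<close>, and the two ways of pairing them up to a total of
  \<open>\<plusminus>4\<close> clash.\<close>

lemma same_class_pair_unique:
  assumes N: "X \<in> N" "Y \<in> N" "Z \<in> N" "W \<in> N" and ne: "X \<noteq> Y" "Z \<noteq> W"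
    and cl: "same_class X Y" "same_class Z W" and eq: "X + Y = Z + W"
  shows "Z = X \<or> Z = Y"
proof (rule ccontr)
  assume Z: "\<not> (Z = X \<or> Z = Y)"
  then have W: "W \<noteq> X" "W \<noteq> Y" using eq by auto
  obtain e where e: "X + Y = 2 * e" "\<bar>e\<bar> = 1"
  proof -
    have "\<bar>X + Y\<bar> = 2" using same_class_sum N ne cl by blast
    then have "X + Y = 2 * 1 \<or> X + Y = 2 * (-1)" by arith
    then show ?thesis using that[of 1] that[of "-1"] by auto
  qed
  have near_e: "p dvd U - e"
    if "p \<in> supp d" "odd p" "odd_cong U V" "U + V = 2 * e" for U V p
  proof -
    have "p dvd U - V" using that unfolding odd_cong_def by blast
    moreover have "U - V = 2 * (U - e)" using that(4) by simp
    ultimately have "p dvd 2 * (U - e)" by simp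
    moreover have "prime p" using that unfolding supp_def by simp
    ultimately show ?thesis using odd_prime_dvd_double that(2) by blast
  qed
  have sym: "odd_cong V U" if "odd_cong U V" for U V
    using that unfolding odd_cong_def by (simp add: dvd_diff_commute)
  have e_cong: "p dvd U - e" if "p \<in> supp d" "odd p" "U \<in> {X, Y, Z, W}" for p U
    using that near_e[of p X Y] near_e[of p Y X] near_e[of p Z W] near_e[of p W Z] cl sym e eq
    unfolding same_class_def by (auto simp: add.commute)
  have all: "odd_cong U V" if UV: "U \<in> {X, Y, Z, W}" "V \<in> {X, Y, Z, W}" for U V
    unfolding odd_cong_def
  proof (intro ballI impI)
    fix p assume p: "p \<in> supp d" "odd p"
    have "p dvd (U - e) - (V - e)" using e_cong[OF p UV(1)] e_cong[OF p UV(2)] by (rule dvd_diff)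
    then show "p dvd U - V" by simp
  qed
  show False
  proof (cases "4 dvd X - Z")
    case True
    then have "4 dvd (X - Z) - (X - Y)" 
      using cl dvd_diff unfolding same_class_def by blast
    then have "4 dvd Y - Z" by simp
    then have "same_class X Z" "same_class Y Z"
      using True all unfolding same_class_def by auto
    then have "\<bar>X + Z\<bar> = 2" "\<bar>Y + Z\<bar> = 2" using same_class_sum N Z by auto
    then show False using e ne(1) Z by arith
  next
    case False
    have pow: "\<exists>j. \<bar>U + V\<bar> = 2 ^ j" if "U \<in> {X, Y}" "V \<in> {Z, W}" for U V
      using that N Z W all by (intro abs_sum_power_of_2) auto
    have "odd X" "odd Y" "odd Z" "odd W" using odd_N N by auto
    moreover have "4 dvd X - Y" "4 dvd Z - W" using cl unfolding same_class_def by auto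
    ultimately have four: "4 dvd X + Z" "4 dvd X + W" "4 dvd Y + Z" "4 dvd Y + W"
      using False by presburger+
    have tot: "(X + Z) + (Y + W) = 4 * e" "(X + W) + (Y + Z) = 4 * e" using e eq by auto
    obtain i j k l where "\<bar>X + Z\<bar> = 2 ^ i" "\<bar>Y + W\<bar> = 2 ^ j" "\<bar>X + W\<bar> = 2 ^ k" "\<bar>Y + Z\<bar> = 2 ^ l"
      using pow[of X Z] pow[of Y W] pow[of X W] pow[of Y Z] by (auto simp: add.commute)
    then have "X + Z = 8 * e \<and> Y + W = - 4 * e \<or> X + Z = - 4 * e \<and> Y + W = 8 * e"
      "X + W = 8 * e \<and> Y + Z = - 4 * e \<or> X + W = - 4 * e \<and> Y + Z = 8 * e"
      using signed_powers_of_2_sum_4[of "X + Z" i "Y + W" j e]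
        signed_powers_of_2_sum_4[of "X + W" k "Y + Z" l e] four tot e(2) by simp_all
    then show False using ne by auto
  qed
qed

lemma finite_supp: "finite (supp d)"
  unfolding supp_def
  by (rule finite_subset[of _ "{0..d}"]) (use d_pos in \<open>auto simp: zdvd_imp_le prime_ge_0_int\<close>)

text \<open>Encoding classes relative to a base point \<open>B\<close> as subsets of \<open>supp d\<close> gives the count \<open>2\<^sup>s\<close> at once.
  At a prime outside the set, \<open>X\<close> is congruent to \<open>-B\<close>; the prime \<open>2\<close>, where the two signs coincide,
  is replaced by \<open>4\<close>.\<close>

definition sign_set :: "int \<Rightarrow> int \<Rightarrow> int set" where
  "sign_set B X = {p \<in> supp d. (if p = 2 then 4 else p) dvd X - B}"

lemma same_class_if_sign_set_eq:
  assumes N: "B \<in> N" "X \<in> N" "Y \<in> N" and eq: "sign_set B X = sign_set B Y"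
  shows "same_class X Y"
  unfolding same_class_def
proof
  have "2 \<in> supp d" using d_even unfolding supp_def by simp
  then have "2 \<in> sign_set B U \<longleftrightarrow> 4 dvd U - B" for U unfolding sign_set_def by simp
  then have "4 dvd X - B \<longleftrightarrow> 4 dvd Y - B" using eq by blast
  moreover have "odd X" "odd Y" "odd B" using odd_N N by auto
  ultimately show "4 dvd X - Y" by presburger
  show "odd_cong X Y"
    unfolding odd_cong_def
  proof (intro ballI impI)
    fix p assume p: "p \<in> supp d" "odd p"
    then have "p \<in> sign_set B U \<longleftrightarrow> p dvd U - B" for U unfolding sign_set_def by auto
    then have same: "p dvd X - B \<longleftrightarrow> p dvd Y - B" using eq by blast
    have sign: "p dvd U - B \<or> p dvd U + B" if "U \<in> N" for U
    proof -
      have "p dvd (U - B) * (U + B)"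
        using square_cong[OF that N(1)] p(1) dvd_trans[of p d]
        unfolding supp_def by (simp add: power2_eq_square algebra_simps)
      then show ?thesis using p(1) unfolding supp_def by (simp add: prime_dvd_mult_iff)
    qed
    show "p dvd X - Y"
    proof (cases "p dvd X - B")
      case True
      then have "p dvd (X - B) - (Y - B)" using same dvd_diff by blast
      then show ?thesis by simp
    next
      case False
      then have "p dvd (X + B) - (Y + B)" 
        using same sign N dvd_diff by blast
      then show ?thesis by simp
    qed
  qed
qed

text \<open>Two members of \<open>N\<close> with the same sign set form one of at most two exceptional pairs, so the sign
  set is injective once a member of each of these pairs is removed.\<close>

lemma card_le: "finite N \<and> card N \<le> 2 ^ card (supp d) + 2"
proof (cases "N = {}")
  case False
  then obtain B where B: "B \<in> N" by blast
  define pair where "pair e X Y \<longleftrightarrow> X \<in> N \<and> Y \<in> N \<and> X \<noteq> Y \<and> same_class X Y \<and> X + Y = e"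
    for e X Y :: int
  \<comment> \<open>If no pair has sum \<open>e\<close>, this is an arbitrary integer, and removing it does no harm.\<close>
  define r where "r e = (SOME X. \<exists>Y. pair e X Y)" for e
  define R where "R = {r 2, r (-2)}"
  have hit: "r e = X \<or> r e = Y" if XY: "pair e X Y" for e X Y
  proof -
    have "\<exists>Y. pair e (r e) Y" unfolding r_def using XY by (metis (mono_tags, lifting))
    then obtain Y' where "pair e (r e) Y'" ..
    then show ?thesis
      using XY same_class_pair_unique[of X Y "r e" Y'] unfolding pair_def by simp
  qed
  have inj: "inj_on (sign_set B) (N - R)"
  proof (rule inj_onI, rule ccontr)
    fix X Y assume XY: "X \<in> N - R" "Y \<in> N - R" "sign_set B X = sign_set B Y" "X \<noteq> Y"
    then have cl: "same_class X Y" using same_class_if_sign_set_eq[OF B] by simp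
    then have "\<bar>X + Y\<bar> = 2" using same_class_sum XY by simp
    then have "X + Y = 2 \<or> X + Y = -2" by arith
    then have "pair 2 X Y \<or> pair (-2) X Y" using XY cl unfolding pair_def by auto
    then show False using hit XY unfolding R_def by blast
  qed
  have sub: "sign_set B ` (N - R) \<subseteq> Pow (supp d)" unfolding sign_set_def by auto
  have finP: "finite (Pow (supp d))" using finite_supp by simp
  have fin: "finite (N - R)" using inj sub finP by (meson finite_imageD finite_subset)
  then have finN: "finite N" unfolding R_def by simp
  have "card (N - R) \<le> 2 ^ card (supp d)"
    using card_inj_on_le[OF inj sub finP] finite_supp by (simp add: card_Pow)
  moreover have "card R \<le> 2" unfolding R_def by (simp add: card_insert_if)
  moreover have "card N - card R \<le> card (N - R)" unfolding R_def by (rule diff_card_le_card_Diff) simp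
  ultimately show ?thesis using finN by linarith
qed simp

end

section \<open>The bound on periodic points\<close>

theorem corollary3p11:
  fixes c :: rat and d :: int and s :: nat
  assumes "den c = d\<^sup>2" and "d > 0" and "4 dvd d"
    and "s = card (supp d)"
  shows "finite (Per (phi c)) \<and> card (Per (phi c)) \<le> 2 ^ s + 2"
proof -
  obtain a where a: "quotient_of c = (a, d\<^sup>2)"
    using assms(1) unfolding den_def by (metis prod.collapse)
  have c: "c = of_int a / (of_int d)\<^sup>2" using quotient_of_div[OF a] by simp
  have cop: "coprime a d" using quotient_of_coprime[OF a] by simp
  have d0: "d \<noteq> 0" using assms(2) by simp
  interpret numerator_set d "numerators c d"
  proof
    show "d > 0" by fact
    show "even d" using assms(3) by presburger
  next
    fix X assume "X \<in> numerators c d"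
    then obtain k where k: "X\<^sup>2 - a = d * k"
      using numerator_square_cong[OF c d0] by (auto elim!: dvdE)
    show "coprime X d"
    proof (rule coprimeI)
      fix q assume q: "q dvd X" "q dvd d"
      have "a = X * X - d * k" using k by (simp add: power2_eq_square)
      then have "q dvd a" using q by simp
      then show "is_unit q" using cop q(2) by (metis coprime_common_divisor)
    qed
  next
    fix X Y assume "X \<in> numerators c d" "Y \<in> numerators c d"
    then have "d dvd (X\<^sup>2 - a) - (Y\<^sup>2 - a)" 
      using numerator_square_cong[OF c d0] dvd_diff by blast
    then show "d dvd X\<^sup>2 - Y\<^sup>2" by simp
  next
    fix X Y assume "X \<in> numerators c d" "Y \<in> numerators c d" "X \<noteq> Y"
    then show "\<exists>n. X + Y dvd d ^ n" by (rule numerator_sum_dvd_power[OF c d0])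
  qed
  have "card (Per (phi c)) \<le> card (numerators c d)"
    unfolding Per_eq_image_numerators[OF c d0] using card_le by (blast intro: card_image_le)
  then show ?thesis
    using card_le assms(4) unfolding Per_eq_image_numerators[OF c d0] by auto
qed

end
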